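(* The hypersequent calculus for DL2 described below is sound: for every hypersequent $\Gamma_1\vdash\Delta_1\mid\cdots\mid\Gamma_k\vdash\Delta_k$ derivable in it, there exists $j$ such that the sequent $\Gamma_j\vdash\Delta_j$ is sound, i.e. $\llbracket\Gamma_j\rrbracket\le\llbracket\Delta_j\rrbracket$.
   Context: DL2 formulas are built from atomic formulas $r_1\le r_2$ and $r_1=r_2$ ($r_1,r_2$ real numbers) and the constant $\top$ using binary connectives $\odot,\oplus,\wedge,\vee,\Rightarrow$. Interpretation $\llbracket\cdot\rrbracket$ into $(-\infty,0]$: $\llbracket r_1\le r_2\rrbracket=-\max(r_1-r_2,0)$, $\llbracket r_1=r_2\rrbracket=-|r_2-r_1|$, $\llbracket\top\rrbracket=0$, $\llbracket p\odot q\rrbracket=\llbracket p\rrbracket+\llbracket q\rrbracket$, $\llbracket p\oplus q\rrbracket=-\llbracket p\rrbracket\llbracket q\rrbracket$, $\llbracket p\wedge q\rrbracket=\min$, $\llbracket p\vee q\rrbracket=\max$, $\llbracket p\Rightarrow q\rrbracket=-\max(\llbracket p\rrbracket-\llbracket q\rrbracket,0)$. A sequent $\Gamma\vdash\Delta$ is a pair of finite lists of formulas; a hypersequent is a finite list of sequents separated by $\mid$. For a list $\Gamma=q_1,\dots,q_n$ put $\llbracket\Gamma\rrbracket=\sum_i\llbracket q_i\rrbracket$ (empty list: $0$); a sequent $\Gamma\vdash\Delta$ is sound if $\llbracket\Gamma\rrbracket\le\llbracket\Delta\rrbracket$. Rules ($H,G$ hypersequents, possibly empty; $\Gamma,\Sigma,\Delta,\Pi$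 lists of formulas; $p,p_0,p_1$ formulas; premises above, conclusion after $\Rightarrow\!\!$): axioms $H\mid p\vdash p$; $H\mid\ \vdash$ (empty sequent); $H\mid\Gamma\vdash\top$. EW: $H$ / $H\mid G$. EC: $H\mid G\mid G$ / $H\mid G$. EE: $H_1\mid G_1\mid G_2\mid H_2$ / $H_1\mid G_2\mid G_1\mid H_2$. W: $H\mid\Gamma\vdash\Delta$ / $H\mid\Gamma,\Sigma\vdash\Delta$. COM: $H\mid\Gamma_1,\Sigma_1\vdash\Delta$ and $H\mid\Gamma_2,\Sigma_2\vdash\Pi$ / $H\mid\Gamma_1,\Gamma_2\vdash\Delta\mid\Sigma_1,\Sigma_2\vdash\Pi$. Left/right exchange of two adjacent formulas in a list. (L$\odot$): $H\mid\Gamma,p_0,p_1\vdash\Delta$ / $H\mid\Gamma,p_0\odot p_1\vdash\Delta$. (R$\odot$): $H\mid\Gamma_0\vdash p_0,\Delta_0$ and $H\mid\Gamma_1\vdash p_1,\Delta_1$ / $H\mid\Gamma_0,\Gamma_1\vdash p_0\odot p_1,\Delta_0,\Delta_1$. (L$\wedge$): $H\mid\Gamma,p_0\vdash\Delta\mid\Gamma,p_1\vdash\Delta$ / $H\mid\Gamma,p_0\wedge p_1\vdash\Delta$. (R$\wedge$): $H\mid\Gamma\vdash p_0,\Delta$ and $H\mid\Gamma\vdash p_1,\Delta$ / $H\mid\Gamma\vdash p_0\wedge p_1,\Delta$. (L$\vee$): $H\mid\Gamma,p_0\vdash\Delta$ and $H\mid\Gamma,p_1\vdash\Delta$ / $H\mid\Gamma,p_0\vee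 p_1\vdash\Delta$. (R$\vee$): $H\mid\Gamma\vdash p_0,\Delta\mid\Gamma\vdash p_1,\Delta$ / $H\mid\Gamma\vdash p_0\vee p_1,\Delta$. (L$\Rightarrow$): $H\mid\Gamma\vdash\Delta$ and $H\mid\Gamma,p_1\vdash p_0,\Delta$ / $H\mid\Gamma,p_0\Rightarrow p_1\vdash\Delta$. (R$\Rightarrow$): $H\mid\Gamma\vdash\Delta$ and $H\mid\Gamma,p_0\vdash p_1,\Delta$ / $H\mid\Gamma\vdash p_0\Rightarrow p_1,\Delta$. Derivable hypersequents are those obtained by finitely many rule applications. *)

theory Defs
  imports Complex_Main
begin

datatype formula =
    Leq real real
  | Equ real real
  | Top (\<open>\<^bold>\<top>\<close>)
  | Tensor formula formula  (infixr \<open>\<^bold>\<odot>\<close> 75)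
  | Par formula formula     (infixr \<open>\<^bold>\<oplus>\<close> 74)
  | Conj formula formula    (infixr \<open>\<^bold>\<and>\<close> 73)
  | Disj formula formula    (infixr \<open>\<^bold>\<or>\<close> 72)
  | Impl formula formula    (infixr \<open>\<^bold>\<Rightarrow>\<close> 71)

primrec interp :: "formula \<Rightarrow> real" (\<open>\<lbrakk>_\<rbrakk>\<close>) where
  "\<lbrakk>Leq r\<^sub>1 r\<^sub>2\<rbrakk> = - max (r\<^sub>1 - r\<^sub>2) 0"
| "\<lbrakk>Equ r\<^sub>1 r\<^sub>2\<rbrakk> = - \<bar>r\<^sub>2 - r\<^sub>1\<bar>"
| "\<lbrakk>\<^bold>\<top>\<rbrakk> = 0"
| "\<lbrakk>p \<^bold>\<odot> q\<rbrakk> = \<lbrakk>p\<rbrakk> + \<lbrakk>q\<rbrakk>"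
| "\<lbrakk>p \<^bold>\<oplus> q\<rbrakk> = - (\<lbrakk>p\<rbrakk> * \<lbrakk>q\<rbrakk>)"
| "\<lbrakk>p \<^bold>\<and> q\<rbrakk> = min \<lbrakk>p\<rbrakk> \<lbrakk>q\<rbrakk>"
| "\<lbrakk>p \<^bold>\<or> q\<rbrakk> = max \<lbrakk>p\<rbrakk> \<lbrakk>q\<rbrakk>"
| "\<lbrakk>p \<^bold>\<Rightarrow> q\<rbrakk> = - max (\<lbrakk>p\<rbrakk> - \<lbrakk>q\<rbrakk>) 0"

text \<open>The interpretation is real-valued; its range is contained in the non-positive reals.\<close>

lemma interp_nonpos: "\<lbrakk>p\<rbrakk> \<le> 0"
  by (induction p) (auto intro: mult_nonpos_nonpos)

definition interp_list :: "formula list \<Rightarrow> real" where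
  "interp_list \<Gamma> = (\<Sum>q\<leftarrow>\<Gamma>. \<lbrakk>q\<rbrakk>)"

datatype sequent =
  Sequent (antecedent: "formula list") (succedent: "formula list")  (infix \<open>\<turnstile>\<close> 55)

type_synonym hypersequent = "sequent list"

definition sequent_sound :: "sequent \<Rightarrow> bool" where
  "sequent_sound S \<longleftrightarrow> interp_list (antecedent S) \<le> interp_list (succedent S)"

text \<open>
  The bar separating the components of a hypersequent is list append. All metavariables \<open>H\<close>, \<open>G\<close>
  range over arbitrary, possibly empty, hypersequents. Since the external exchange rule is
  available, the active components can always be displayed at the end.
\<close>

inductive derivable :: "hypersequent \<Rightarrow> bool" where
  Ax_id: "derivable (H @ [[p] \<turnstile> [p]])"
| Ax_empty: "derivable (H @ [[] \<turnstile> []])"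
| Ax_top: "derivable (H @ [\<Gamma> \<turnstile> [\<^bold>\<top>]])"
| EW: "derivable H \<Longrightarrow> derivable (H @ G)"
| EC: "derivable (H @ G @ G) \<Longrightarrow> derivable (H @ G)"
| EE: "derivable (H\<^sub>1 @ G\<^sub>1 @ G\<^sub>2 @ H\<^sub>2) \<Longrightarrow> derivable (H\<^sub>1 @ G\<^sub>2 @ G\<^sub>1 @ H\<^sub>2)"
| W: "derivable (H @ [\<Gamma> \<turnstile> \<Delta>]) \<Longrightarrow> derivable (H @ [\<Gamma> @ \<Sigma> \<turnstile> \<Delta>])"
| COM: "\<lbrakk> derivable (H @ [\<Gamma>\<^sub>1 @ \<Sigma>\<^sub>1 \<turnstile> \<Delta>]); derivable (H @ [\<Gamma>\<^sub>2 @ \<Sigma>\<^sub>2 \<turnstile> \<Pi>]) \<rbrakk>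
    \<Longrightarrow> derivable (H @ [\<Gamma>\<^sub>1 @ \<Gamma>\<^sub>2 \<turnstile> \<Delta>, \<Sigma>\<^sub>1 @ \<Sigma>\<^sub>2 \<turnstile> \<Pi>])"
| L_exch: "derivable (H @ [\<Gamma> @ [p, q] @ \<Sigma> \<turnstile> \<Delta>]) \<Longrightarrow> derivable (H @ [\<Gamma> @ [q, p] @ \<Sigma> \<turnstile> \<Delta>])"
| R_exch: "derivable (H @ [\<Gamma> \<turnstile> \<Delta> @ [p, q] @ \<Pi>]) \<Longrightarrow> derivable (H @ [\<Gamma> \<turnstile> \<Delta> @ [q, p] @ \<Pi>])"
| L_tensor: "derivable (H @ [\<Gamma> @ [p\<^sub>0, p\<^sub>1] \<turnstile> \<Delta>]) \<Longrightarrow> derivable (H @ [\<Gamma> @ [p\<^sub>0 \<^bold>\<odot> p\<^sub>1] \<turnstile> \<Delta>])"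
| R_tensor: "\<lbrakk> derivable (H @ [\<Gamma>\<^sub>0 \<turnstile> [p\<^sub>0] @ \<Delta>\<^sub>0]); derivable (H @ [\<Gamma>\<^sub>1 \<turnstile> [p\<^sub>1] @ \<Delta>\<^sub>1]) \<rbrakk>
    \<Longrightarrow> derivable (H @ [\<Gamma>\<^sub>0 @ \<Gamma>\<^sub>1 \<turnstile> [p\<^sub>0 \<^bold>\<odot> p\<^sub>1] @ \<Delta>\<^sub>0 @ \<Delta>\<^sub>1])"
| L_conj: "derivable (H @ [\<Gamma> @ [p\<^sub>0] \<turnstile> \<Delta>, \<Gamma> @ [p\<^sub>1] \<turnstile> \<Delta>])
    \<Longrightarrow> derivable (H @ [\<Gamma> @ [p\<^sub>0 \<^bold>\<and> p\<^sub>1] \<turnstile> \<Delta>])"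
| R_conj: "\<lbrakk> derivable (H @ [\<Gamma> \<turnstile> [p\<^sub>0] @ \<Delta>]); derivable (H @ [\<Gamma> \<turnstile> [p\<^sub>1] @ \<Delta>]) \<rbrakk>
    \<Longrightarrow> derivable (H @ [\<Gamma> \<turnstile> [p\<^sub>0 \<^bold>\<and> p\<^sub>1] @ \<Delta>])"
| L_disj: "\<lbrakk> derivable (H @ [\<Gamma> @ [p\<^sub>0] \<turnstile> \<Delta>]); derivable (H @ [\<Gamma> @ [p\<^sub>1] \<turnstile> \<Delta>]) \<rbrakk>
    \<Longrightarrow> derivable (H @ [\<Gamma> @ [p\<^sub>0 \<^bold>\<or> p\<^sub>1] \<turnstile> \<Delta>])"
| R_disj: "derivable (H @ [\<Gamma> \<turnstile> [p\<^sub>0] @ \<Delta>, \<Gamma> \<turnstile> [p\<^sub>1] @ \<Delta>])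
    \<Longrightarrow> derivable (H @ [\<Gamma> \<turnstile> [p\<^sub>0 \<^bold>\<or> p\<^sub>1] @ \<Delta>])"
| L_impl: "\<lbrakk> derivable (H @ [\<Gamma> \<turnstile> \<Delta>]); derivable (H @ [\<Gamma> @ [p\<^sub>1] \<turnstile> [p\<^sub>0] @ \<Delta>]) \<rbrakk>
    \<Longrightarrow> derivable (H @ [\<Gamma> @ [p\<^sub>0 \<^bold>\<Rightarrow> p\<^sub>1] \<turnstile> \<Delta>])"
| R_impl: "\<lbrakk> derivable (H @ [\<Gamma> \<turnstile> \<Delta>]); derivable (H @ [\<Gamma> @ [p\<^sub>0] \<turnstile> [p\<^sub>1] @ \<Delta>]) \<rbrakk>
    \<Longrightarrow> derivable (H @ [\<Gamma> \<turnstile> [p\<^sub>0 \<^bold>\<Rightarrow> p\<^sub>1] @ \<Delta>])"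

end

theory Submission
  imports Defs
begin

text \<open>Induction on the derivation: each rule preserves the existence of a sound component. A
  sound component of a shared context \<open>H\<close> survives; otherwise the active components
  supply inequalities between real sums, and arithmetic gives the conclusion.
  \<open>interp_list_nonpos\<close> handles \<open>Ax_top\<close> and \<open>W\<close>.\<close>

lemma interp_list_simps [simp]:
  "interp_list [] = 0"
  "interp_list (p # \<Gamma>) = \<lbrakk>p\<rbrakk> + interp_list \<Gamma>"
  "interp_list (\<Gamma> @ \<Delta>) = interp_list \<Gamma> + interp_list \<Delta>"
  by (simp_all add: interp_list_def)

lemma interp_list_nonpos: "interp_list \<Gamma> \<le> 0"
  by (induction \<Gamma>) (auto intro: add_nonpos_nonpos interp_nonpos)

lemma sequent_sound_iff [simp]:
  "sequent_sound (\<Gamma> \<turnstile> \<Delta>) \<longleftrightarrow> interp_list \<Gamma> \<le> interp_list \<Delta>"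
  by (simp add: sequent_sound_def)

lemma derivable_imp_sequent_sound:
  "derivable \<H> \<Longrightarrow> \<exists>S \<in> set \<H>. sequent_sound S"
proof (induction rule: derivable.induct)
  case (Ax_top H \<Gamma>)
  then show ?case using interp_list_nonpos[of \<Gamma>] by simp
next
  case (W H \<Gamma> \<Delta> \<Sigma>)
  then show ?case using interp_list_nonpos[of \<Sigma>] by auto
\<comment> \<open>For \<open>COM\<close>, adding the two premise inequalities bounds the total of
  both conclusion antecedents by that of both succedents, so the two components cannot both fail.
  The lattice and implication rules split on which argument attains \<open>min\<close> or
  \<open>max\<close>.\<close>
qed (auto simp: min_def max_def algebra_simps split: if_splits)

theorem theorem5:
  fixes \<H> :: hypersequent
  assumes "derivable \<H>"
  shows "\<exists>j < length \<H>. sequent_sound (\<H> ! j)"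
  using derivable_imp_sequent_sound[OF assms] by (metis in_set_conv_nth)

end
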